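(* Let $\Delta$ be a countable homogeneous relational structure with the joint extension property such that $\operatorname{Aut}(\Delta)$ has no algebraicity and $\operatorname{Aut}(\Delta)$ has automatic homeomorphicity. Then the monoid $\overline{\operatorname{Aut}(\Delta)}$ of self-embeddings of $\Delta$ has automatic homeomorphicity.
   Context: Let $D$ be the domain of $\Delta$ (countably infinite). $\mathbf O^{(1)}$ is the monoid of all functions from a countably infinite set to itself with the topology of pointwise convergence (domain discrete), and $\mathbf S$ is its group of all permutations with the subspace topology. $\overline{\operatorname{Aut}(\Delta)}$ is the closure of $\operatorname{Aut}(\Delta)$ in the monoid of all functions $D\to D$; for homogeneous relational $\Delta$ it is the monoid of self-embeddings of $\Delta$. A closed subgroup $G$ of $\mathbf S$ has automatic homeomorphicity if every group isomorphism between $G$ and a closed subgroup of $\mathbf S$ is a homeomorphism. A closed submonoid $M$ of $\mathbf O^{(1)}$ has automatic homeomorphicity if every monoid isomorphism between $M$ and a closed submonoid of $\mathbf O^{(1)}$ is a homeomorphism. A partial isomorphism of $\Delta$ is an isomorphism between finite substructures of $\Delta$. $\Delta$ is homogeneous if every partial isomorphism of $\Delta$ extends to an automorphism of $\Delta$. A permutation group $G$ has no algebraicity if for every finite tuple $(a_1,\dots,a_n)$ of elements of the domain, the set of all permutations in $G$ that fix each of $a_1,\dots,a_n$ fixes no other elements of the domain. $\Delta$ has the joint extension property if for all partial isomorphisms $a_1,a_2$ of $\Delta$ with $\operatorname{Dom}(a_1)=\operatorname{Dom}(a_2)$ and $a_1^{-1}(x)=a_2^{-1}(x)$ for all $x\in\operatorname{Im}(a_1)\cap\operatorname{Im}(a_2)$,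 and for every element $u$ of $\Delta$ outside $\operatorname{Dom}(a_1)=\operatorname{Dom}(a_2)$, there exist partial isomorphisms $a_1'$ extending $a_1$ and $a_2'$ extending $a_2$, both defined on $u$, such that $a_1'(u)=a_2'(u)$. *)

theory Defs
  imports "HOL-Analysis.Function_Topology" "HOL-Algebra.Bij"
begin

(* HOL-Algebra's structure closure clashes with the topological closure_of *)
no_notation eq_closure_of (\<open>closure'_of\<index>\<close>)

section \<open>Transformation monoids and automatic homeomorphicity\<close>

text \<open>The ground set is the universe of the type \<open>'a\<close>; the main statement assumes it to be
  countably infinite. On \<open>UNIV\<close> the extensionality requirement in \<^const>\<open>BijGroup\<close> is void, so
  \<open>BijGroup UNIV\<close> is the group of all permutations of \<open>'a\<close>.\<close>

definition transformation_monoid :: "('a \<Rightarrow> 'a) monoid"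
  where "transformation_monoid = \<lparr>carrier = UNIV, mult = (\<circ>), one = id\<rparr>"

definition pointwise_topology :: "('a \<Rightarrow> 'a) topology"
  where "pointwise_topology = product_topology (\<lambda>_. discrete_topology UNIV) UNIV"

definition closed_permutation_group :: "('a \<Rightarrow> 'a) set \<Rightarrow> bool"
  where "closed_permutation_group G \<longleftrightarrow>
    subgroup G (BijGroup UNIV) \<and>
    closedin (subtopology pointwise_topology (carrier (BijGroup UNIV))) G"

definition closed_transformation_monoid :: "('a \<Rightarrow> 'a) set \<Rightarrow> bool"
  where "closed_transformation_monoid M \<longleftrightarrow>
    submonoid M transformation_monoid \<and> closedin pointwise_topology M"

definition group_automatic_homeomorphicity :: "('a \<Rightarrow> 'a) set \<Rightarrow> bool"
  where "group_automatic_homeomorphicity G \<longleftrightarrow>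
    closed_permutation_group G \<and>
    (\<forall>(H :: ('a \<Rightarrow> 'a) set) h. closed_permutation_group H \<longrightarrow>
      h \<in> iso (BijGroup UNIV\<lparr>carrier := G\<rparr>) (BijGroup UNIV\<lparr>carrier := H\<rparr>) \<longrightarrow>
      homeomorphic_map (subtopology pointwise_topology G) (subtopology pointwise_topology H) h)"

text \<open>Membership in \<^const>\<open>iso\<close> does not ask explicitly for preservation of the identity, but a
  multiplicative bijection between monoids preserves it.\<close>

definition monoid_automatic_homeomorphicity :: "('a \<Rightarrow> 'a) set \<Rightarrow> bool"
  where "monoid_automatic_homeomorphicity M \<longleftrightarrow>
    closed_transformation_monoid M \<and>
    (\<forall>(N :: ('a \<Rightarrow> 'a) set) h. closed_transformation_monoid N \<longrightarrow>
      h \<in> iso (transformation_monoid\<lparr>carrier := M\<rparr>) (transformation_monoid\<lparr>carrier := N\<rparr>) \<longrightarrow>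
      homeomorphic_map (subtopology pointwise_topology M) (subtopology pointwise_topology N) h)"

definition no_algebraicity :: "('a \<Rightarrow> 'a) set \<Rightarrow> bool"
  where "no_algebraicity G \<longleftrightarrow>
    (\<forall>as x. (\<forall>g\<in>G. (\<forall>a\<in>set as. g a = a) \<longrightarrow> g x = x) \<longrightarrow> x \<in> set as)"


section \<open>Relational structures\<close>

text \<open>A relational structure with domain \<open>'a\<close>, over an arbitrary (possibly empty or infinite) set
  of relation symbols; tuples are lists.\<close>

record ('r, 'a) rel_structure =
  symbols :: "'r set"
  arity :: "'r \<Rightarrow> nat"
  interp :: "'r \<Rightarrow> 'a list set"

definition relational_structure :: "('r, 'a) rel_structure \<Rightarrow> bool"
  where "relational_structure \<Delta> \<longleftrightarrow>
    (\<forall>R\<in>symbols \<Delta>. \<forall>xs\<in>interp \<Delta> R. length xs = arity \<Delta> R)"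

definition self_embeddings :: "('r, 'a) rel_structure \<Rightarrow> ('a \<Rightarrow> 'a) set"
  where "self_embeddings \<Delta> = {f. inj f \<and>
    (\<forall>R\<in>symbols \<Delta>. \<forall>xs. length xs = arity \<Delta> R \<longrightarrow>
      (map f xs \<in> interp \<Delta> R \<longleftrightarrow> xs \<in> interp \<Delta> R))}"

definition automorphisms :: "('r, 'a) rel_structure \<Rightarrow> ('a \<Rightarrow> 'a) set"
  where "automorphisms \<Delta> = {f \<in> self_embeddings \<Delta>. bij f}"

text \<open>A partial isomorphism is encoded as a finite partial map \<open>p\<close>; it is an isomorphism between
  the substructures induced on \<open>dom p\<close> and \<open>ran p\<close>.\<close>

definition partial_isomorphism :: "('r, 'a) rel_structure \<Rightarrow> ('a \<rightharpoonup> 'a) \<Rightarrow> bool"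
  where "partial_isomorphism \<Delta> p \<longleftrightarrow>
    finite (dom p) \<and> inj_on p (dom p) \<and>
    (\<forall>R\<in>symbols \<Delta>. \<forall>xs. length xs = arity \<Delta> R \<longrightarrow> set xs \<subseteq> dom p \<longrightarrow>
      (map (the \<circ> p) xs \<in> interp \<Delta> R \<longleftrightarrow> xs \<in> interp \<Delta> R))"

definition homogeneous :: "('r, 'a) rel_structure \<Rightarrow> bool"
  where "homogeneous \<Delta> \<longleftrightarrow>
    (\<forall>p. partial_isomorphism \<Delta> p \<longrightarrow>
      (\<exists>g\<in>automorphisms \<Delta>. \<forall>x\<in>dom p. p x = Some (g x)))"

text \<open>The third hypothesis says that the inverses of \<open>p\<close> and \<open>q\<close> agree on
  \<open>ran p \<inter> ran q\<close>.\<close>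

definition joint_extension_property :: "('r, 'a) rel_structure \<Rightarrow> bool"
  where "joint_extension_property \<Delta> \<longleftrightarrow>
    (\<forall>p q u. partial_isomorphism \<Delta> p \<longrightarrow> partial_isomorphism \<Delta> q \<longrightarrow> dom p = dom q \<longrightarrow>
      (\<forall>x y z. p y = Some x \<longrightarrow> q z = Some x \<longrightarrow> y = z) \<longrightarrow>
      u \<notin> dom p \<longrightarrow>
      (\<exists>p' q'. partial_isomorphism \<Delta> p' \<and> partial_isomorphism \<Delta> q' \<and>
        p \<subseteq>\<^sub>m p' \<and> q \<subseteq>\<^sub>m q' \<and> u \<in> dom p' \<and> u \<in> dom q' \<and> p' u = q' u))"

text \<open>For homogeneous structures, the closure of the automorphism group in the monoid of all
  transformations is the monoid of self-embeddings.\<close>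

lemma openin_pointwise_cylinder:
  assumes "finite F"
  shows "openin pointwise_topology {g. \<forall>x\<in>F. g x = f x}"
proof -
  have "openin pointwise_topology (Pi\<^sub>E UNIV (\<lambda>x. if x \<in> F then {f x} else UNIV))"
    unfolding pointwise_topology_def
  proof (rule product_topology_basis)
    show "finite {x. (if x \<in> F then {f x} else UNIV) \<noteq> topspace (discrete_topology UNIV)}"
      by (rule finite_subset[OF _ assms]) auto
  qed simp
  also have "Pi\<^sub>E UNIV (\<lambda>x. if x \<in> F then {f x} else UNIV) = {g. \<forall>x\<in>F. g x = f x}"
    by (auto simp: PiE_def Pi_def split: if_splits)
  finally show ?thesis .
qed

lemma in_pointwise_closure_iff:
  "f \<in> pointwise_topology closure_of A \<longleftrightarrow> (\<forall>F. finite F \<longrightarrow> (\<exists>g\<in>A. \<forall>x\<in>F. g x = f x))"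
proof
  assume f: "f \<in> pointwise_topology closure_of A"
  show "\<forall>F. finite F \<longrightarrow> (\<exists>g\<in>A. \<forall>x\<in>F. g x = f x)"
  proof (intro allI impI)
    fix F :: "'a set" assume "finite F"
    define C where "C = {g. \<forall>x\<in>F. g x = f x}"
    have "openin pointwise_topology C"
      unfolding C_def using \<open>finite F\<close> by (rule openin_pointwise_cylinder)
    moreover have "f \<in> C" by (simp add: C_def)
    moreover have "\<exists>g. g \<in> A \<and> g \<in> T" if "f \<in> T" "openin pointwise_topology T" for T
      using f that unfolding in_closure_of by simp
    ultimately obtain g where "g \<in> A" "g \<in> C" by blast
    then show "\<exists>g\<in>A. \<forall>x\<in>F. g x = f x" unfolding C_def by blast
  qed
next
  assume R: "\<forall>F. finite F \<longrightarrow> (\<exists>g\<in>A. \<forall>x\<in>F. g x = f x)"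
  have "\<exists>g\<in>A. g \<in> T" if T: "f \<in> T" "openin pointwise_topology T" for T
  proof -
    have "openin (product_topology (\<lambda>_. discrete_topology UNIV) UNIV) T"
      using T(2) by (simp only: pointwise_topology_def)
    from this[unfolded openin_product_topology_alt, rule_format, OF T(1)]
    obtain U where "finite {i \<in> UNIV. U i \<noteq> topspace (discrete_topology UNIV)}"
      and U: "f \<in> Pi\<^sub>E UNIV U" "Pi\<^sub>E UNIV U \<subseteq> T"
      by (elim exE conjE)
    then have fin: "finite {i. U i \<noteq> UNIV}" by simp
    from R[rule_format, OF fin] obtain g where g: "g \<in> A" "\<forall>x\<in>{i. U i \<noteq> UNIV}. g x = f x"
      by blast
    have "g x \<in> U x" for x
    proof (cases "U x = UNIV")
      case False
      then show ?thesis using g(2) U(1) by (simp add: PiE_UNIV_domain Pi_iff)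
    qed simp
    then have "g \<in> Pi\<^sub>E UNIV U" by (simp add: PiE_UNIV_domain)
    with g(1) U(2) show ?thesis by blast
  qed
  moreover have "f \<in> topspace pointwise_topology"
    by (simp add: pointwise_topology_def)
  ultimately show "f \<in> pointwise_topology closure_of A"
    by (simp add: in_closure_of Bex_def)
qed

lemma closure_automorphisms_eq_self_embeddings:
  assumes "homogeneous \<Delta>"
  shows "pointwise_topology closure_of automorphisms \<Delta> = self_embeddings \<Delta>"
proof (intro equalityI subsetI)
  fix f assume "f \<in> pointwise_topology closure_of automorphisms \<Delta>"
  then have ex: "\<exists>g\<in>automorphisms \<Delta>. \<forall>x\<in>F. g x = f x" if "finite F" for F
    using that by (simp add: in_pointwise_closure_iff)
  have "x = y" if "f x = f y" for x y
  proof -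
    obtain g where "g \<in> automorphisms \<Delta>" "g x = f x" "g y = f y"
      using ex[of "{x, y}"] by auto
    then show ?thesis
      using that by (metis (no_types, lifting) automorphisms_def bij_is_inj injD mem_Collect_eq)
  qed
  moreover have "map f xs \<in> interp \<Delta> R \<longleftrightarrow> xs \<in> interp \<Delta> R"
    if "R \<in> symbols \<Delta>" "length xs = arity \<Delta> R" for R xs
  proof -
    obtain g where g: "g \<in> automorphisms \<Delta>" "\<forall>x\<in>set xs. g x = f x"
      using ex[of "set xs"] by auto
    from g(2) have eq: "map f xs = map g xs" by simp
    from g(1) that have "map g xs \<in> interp \<Delta> R \<longleftrightarrow> xs \<in> interp \<Delta> R"
      by (auto simp: automorphisms_def self_embeddings_def)
    then show ?thesis unfolding eq .
  qed
  ultimately show "f \<in> self_embeddings \<Delta>"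
    by (simp add: self_embeddings_def inj_def)
next
  fix f assume f: "f \<in> self_embeddings \<Delta>"
  have "\<exists>g\<in>automorphisms \<Delta>. \<forall>x\<in>F. g x = f x" if "finite F" for F
  proof -
    define p where "p = (\<lambda>x. if x \<in> F then Some (f x) else None)"
    have dom: "dom p = F" by (auto simp: p_def dom_def)
    have "inj_on p F"
      using f by (auto simp: self_embeddings_def p_def inj_on_def)
    moreover have "map (the \<circ> p) xs \<in> interp \<Delta> R \<longleftrightarrow> xs \<in> interp \<Delta> R"
      if "R \<in> symbols \<Delta>" "length xs = arity \<Delta> R" "set xs \<subseteq> F" for R xs
    proof -
      from that(3) have eq: "map (the \<circ> p) xs = map f xs" by (auto simp: p_def)
      from f that have "map f xs \<in> interp \<Delta> R \<longleftrightarrow> xs \<in> interp \<Delta> R"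
        by (auto simp: self_embeddings_def)
      then show ?thesis unfolding eq .
    qed
    ultimately have "partial_isomorphism \<Delta> p"
      using \<open>finite F\<close> unfolding partial_isomorphism_def dom by blast
    then obtain g where "g \<in> automorphisms \<Delta>" "\<forall>x\<in>F. p x = Some (g x)"
      using assms unfolding homogeneous_def dom[symmetric] by blast
    then show ?thesis by (metis p_def option.inject)
  qed
  then show "f \<in> pointwise_topology closure_of automorphisms \<Delta>"
    by (simp add: in_pointwise_closure_iff)
qed

end

theory Submission
  imports Defs
begin

text \<open>
  Let \<open>G\<close> be the automorphism group and \<open>M\<close> its closure in the monoid of all functions. An
  isomorphism \<open>h\<close> from \<open>M\<close> onto a closed monoid maps the units of \<open>M\<close>, which are the elements of
  \<open>G\<close>, onto the units of that monoid. These form a closed permutation group, so \<open>h\<close> restricted to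
  \<open>G\<close> is a homeomorphism. A continuous group homomorphism is uniformly continuous and therefore
  extends to a continuous homomorphism \<open>\<xi>\<close> on \<open>M\<close>. The question is whether \<open>h = \<xi>\<close>. Since
  \<open>h\<inverse> \<circ> \<xi>\<close> is an injective endomorphism of \<open>M\<close> that fixes every element of \<open>G\<close>, it suffices that
  the identity is the only such endomorphism; this is the reduction in
  \<open>monoid_automatic_homeomorphicity_closure\<close>.

  For the rigidity (\<open>endomorphism_fixing_group_is_identity\<close>), let \<open>\<phi>\<close> be such an endomorphism. Equations
  between values of functions are expressed by compositions: if \<open>e1\<close> and \<open>e2\<close> agree
  everywhere except at \<open>b\<close>, then \<open>e1 \<circ> f = e2 \<circ> f\<close> says exactly that \<open>f\<close> omits the
  value \<open>b\<close>. The joint extension property provides such pairs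
  (\<open>embeddings_differing_at_one_point\<close>). The absence of algebraicity provides an element of \<open>M\<close>
  whose range is so sparse that its translates \<open>k\<close> can omit \<open>b\<close> while \<open>\<phi> k\<close> attains any prescribed
  other value (\<open>sparse_range_exists\<close>). Hence \<open>\<phi> e1\<close> and \<open>\<phi> e2\<close> also agree away from \<open>b\<close>; being
  distinct by injectivity of \<open>\<phi>\<close>, they differ at \<open>b\<close>, so \<open>\<phi> f\<close> omits every value that \<open>f\<close> omits.
  Applied to compositions \<open>f \<circ> k\<close> with such \<open>k\<close>, this control of ranges pins down each value of
  \<open>\<phi> f\<close>.
\<close>

(* so that inv denotes the inverse function *)
unbundle no m_inv_syntax

section \<open>Pointwise convergence\<close>

lemma topspace_subtopology_pointwise: "topspace (subtopology pointwise_topology A) = A"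
  by (simp add: pointwise_topology_def)

lemma subset_pointwise_closure: "A \<subseteq> pointwise_topology closure_of A"
  by (auto simp: in_pointwise_closure_iff)

lemma closedin_pointwise_iff:
  "closedin pointwise_topology A \<longleftrightarrow> pointwise_topology closure_of A = A"
  by (rule closure_of_eq[symmetric])

lemma pointwise_closure_injective:
  assumes "\<And>g. g \<in> G \<Longrightarrow> inj g" and "f \<in> pointwise_topology closure_of G"
  shows "inj f"
proof (rule injI)
  fix x y assume "f x = f y"
  moreover obtain g where g: "g \<in> G" "\<forall>z\<in>{x, y}. g z = f z"
    using assms(2) unfolding in_pointwise_closure_iff by (meson finite.emptyI finite.insertI)
  ultimately have "g x = g y" by simp
  then show "x = y" using assms(1)[OF g(1)] by (rule injD[rotated])
qed

lemma pointwise_closure_comp: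
  assumes "\<And>f g. f \<in> G \<Longrightarrow> g \<in> G \<Longrightarrow> f \<circ> g \<in> G"
    and "f \<in> pointwise_topology closure_of G" and "g \<in> pointwise_topology closure_of G"
  shows "f \<circ> g \<in> pointwise_topology closure_of G"
  unfolding in_pointwise_closure_iff
proof (intro allI impI)
  fix F :: "'a set" assume "finite F"
  then obtain g' where g': "g' \<in> G" "\<forall>x\<in>F. g' x = g x"
    using assms(3) unfolding in_pointwise_closure_iff by blast
  obtain f' where f': "f' \<in> G" "\<forall>x\<in>g ` F. f' x = f x"
    using assms(2) \<open>finite F\<close> unfolding in_pointwise_closure_iff by (meson finite_imageI)
  show "\<exists>h\<in>G. \<forall>x\<in>F. h x = (f \<circ> g) x"
    using f' g' by (intro bexI[of _ "f' \<circ> g'"] assms(1)) auto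
qed

text \<open>Elements of the closure are built by such limits: each value is settled once its argument has
  entered some \<open>K n\<close>, and since the \<open>K n\<close> increase, every finite set is contained in one of them.\<close>

lemma pointwise_limit_in_closure:
  fixes s :: "nat \<Rightarrow> 'a \<Rightarrow> 'a"
  assumes "\<And>n. s n \<in> G" and "\<And>n x. x \<in> K n \<Longrightarrow> s (Suc n) x = s n x"
    and "mono K" and "(\<Union>n. K n) = UNIV"
  obtains f where "f \<in> pointwise_topology closure_of G" and "\<And>n x. x \<in> K n \<Longrightarrow> f x = s n x"
proof -
  have stable: "s m x = s n x" if "n \<le> m" "x \<in> K n" for n m x
    using that
  proof (induction rule: dec_induct)
    case (step m)
    then have "x \<in> K m" using monoD[OF \<open>mono K\<close>, of n m] by blast
    then show ?case using step assms(2) by simp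
  qed simp
  have cover: "\<exists>n. x \<in> K n" for x
    using assms(4) by blast
  define f where "f = (\<lambda>x. s (LEAST n. x \<in> K n) x)"
  have f: "f x = s n x" if "x \<in> K n" for n x
    unfolding f_def by (metis LeastI Least_le stable that)
  have "\<exists>n. F \<subseteq> K n" if "finite F" for F
    using that
  proof induction
    case (insert x F)
    then obtain n m where "F \<subseteq> K n" "x \<in> K m" using cover by blast
    then have "insert x F \<subseteq> K (max n m)"
      using monoD[OF \<open>mono K\<close>, of n "max n m"] monoD[OF \<open>mono K\<close>, of m "max n m"] by auto
    then show ?case ..
  qed simp
  then have "f \<in> pointwise_topology closure_of G"
    unfolding in_pointwise_closure_iff by (metis assms(1) f subsetD)
  then show thesis using f that by blast
qed

lemma openin_pointwise_cylinder_exists: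
  assumes "openin pointwise_topology T" and "f \<in> T"
  obtains F where "finite F" and "{g. \<forall>x\<in>F. g x = f x} \<subseteq> T"
proof -
  have "closedin pointwise_topology (- T)"
    using assms(1) by (simp add: closedin_def pointwise_topology_def Compl_eq_Diff_UNIV double_diff)
  then have "f \<notin> pointwise_topology closure_of (- T)"
    using assms(2) by (simp add: closedin_pointwise_iff)
  then show thesis using that unfolding in_pointwise_closure_iff by blast
qed

lemma continuous_map_pointwise_iff:
  "continuous_map (subtopology pointwise_topology A) (subtopology pointwise_topology B) h \<longleftrightarrow>
    h ` A \<subseteq> B \<and>
    (\<forall>f\<in>A. \<forall>x. \<exists>F. finite F \<and> (\<forall>g\<in>A. (\<forall>y\<in>F. g y = f y) \<longrightarrow> h g x = h f x))"
    (is "?C \<longleftrightarrow> ?I \<and> ?L")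
proof (intro iffI conjI)
  {
    assume C: ?C
    show ?I
      using continuous_map_image_subset_topspace[OF C] unfolding topspace_subtopology_pointwise .
    show ?L
    proof (intro ballI allI)
      fix f x assume f: "f \<in> A"
      have "openin (subtopology pointwise_topology B) ({g. \<forall>y\<in>{x}. g y = h f y} \<inter> B)"
        by (intro openin_subtopology_Int openin_pointwise_cylinder) simp
      from openin_continuous_map_preimage[OF C this]
      have "openin (subtopology pointwise_topology A) {g \<in> A. h g \<in> {g. \<forall>y\<in>{x}. g y = h f y} \<inter> B}"
        by (simp only: topspace_subtopology_pointwise)
      then obtain T where T: "openin pointwise_topology T"
        "{g \<in> A. h g \<in> {g. \<forall>y\<in>{x}. g y = h f y} \<inter> B} = T \<inter> A"
        unfolding openin_subtopology by blast
      have "f \<in> T" using T(2) f \<open>?I\<close> by blast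
      with T(1) obtain F where "finite F" "{g. \<forall>x\<in>F. g x = f x} \<subseteq> T"
        by (rule openin_pointwise_cylinder_exists)
      then show "\<exists>F. finite F \<and> (\<forall>g\<in>A. (\<forall>y\<in>F. g y = f y) \<longrightarrow> h g x = h f x)"
        using T(2) by (intro exI[of _ F]) blast
    qed
  }
  assume R: "?I \<and> ?L"
  have "openin (subtopology pointwise_topology A) {f \<in> A. h f x \<in> U}" for x U
  proof (subst openin_subopen, intro ballI)
    fix f assume f: "f \<in> {f \<in> A. h f x \<in> U}"
    then obtain F where F: "finite F" "\<forall>g\<in>A. (\<forall>y\<in>F. g y = f y) \<longrightarrow> h g x = h f x"
      using R by blast
    then have "openin (subtopology pointwise_topology A) ({g. \<forall>y\<in>F. g y = f y} \<inter> A)"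
      by (intro openin_subtopology_Int openin_pointwise_cylinder)
    moreover have "f \<in> {g. \<forall>y\<in>F. g y = f y} \<inter> A" using f by simp
    moreover have "{g. \<forall>y\<in>F. g y = f y} \<inter> A \<subseteq> {f \<in> A. h f x \<in> U}"
      using F(2) f by auto
    ultimately show "\<exists>T. openin (subtopology pointwise_topology A) T \<and> f \<in> T \<and>
        T \<subseteq> {f \<in> A. h f x \<in> U}"
      by blast
  qed
  then have "continuous_map (subtopology pointwise_topology A) (discrete_topology UNIV) (\<lambda>f. h f x)" for x
    by (simp only: continuous_map_def topspace_subtopology_pointwise) simp
  then have "continuous_map (subtopology pointwise_topology A) pointwise_topology h"
    by (subst (2) pointwise_topology_def) (simp only: continuous_map_componentwise_UNIV simp_thms)
  then show ?C
    using R by (auto simp: continuous_map_in_subtopology topspace_subtopology_pointwise)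
qed

lemma homeomorphic_map_pointwise_iff:
  assumes "bij_betw h A B"
  shows "homeomorphic_map (subtopology pointwise_topology A) (subtopology pointwise_topology B) h \<longleftrightarrow>
    (\<forall>f\<in>A. \<forall>x. \<exists>F. finite F \<and> (\<forall>g\<in>A. (\<forall>y\<in>F. g y = f y) \<longrightarrow> h g x = h f x)) \<and>
    (\<forall>f\<in>A. \<forall>x. \<exists>F. finite F \<and> (\<forall>g\<in>A. (\<forall>y\<in>F. h g y = h f y) \<longrightarrow> g x = f x))"
    (is "homeomorphic_map ?X ?Y h \<longleftrightarrow> ?L1 \<and> ?L2")
proof -
  have img: "h ` A = B" and inj: "inj_on h A"
    using assms by (auto simp: bij_betw_def)
  let ?k = "inv_into A h"
  have k: "?k (h f) = f" if "f \<in> A" for f using inj that by simp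
  have "homeomorphic_map ?X ?Y h \<longleftrightarrow> homeomorphic_maps ?X ?Y h ?k"
  proof
    assume "homeomorphic_map ?X ?Y h"
    then obtain k' where hk: "homeomorphic_maps ?X ?Y h k'"
      unfolding homeomorphic_map_maps ..
    have "k' y = ?k y" if y: "y \<in> topspace ?Y" for y
    proof -
      obtain f where f: "f \<in> A" "y = h f"
        using y img by (auto simp: topspace_subtopology_pointwise)
      then have "k' (h f) = f"
        using hk unfolding homeomorphic_maps_def topspace_subtopology_pointwise by blast
      then show ?thesis using f k by simp
    qed
    then show "homeomorphic_maps ?X ?Y h ?k"
      using homeomorphic_maps_eq[OF hk, of h ?k] by blast
  next
    assume "homeomorphic_maps ?X ?Y h ?k"
    then show "homeomorphic_map ?X ?Y h" by (metis homeomorphic_map_maps)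
  qed
  also have "\<dots> \<longleftrightarrow> continuous_map ?X ?Y h \<and> continuous_map ?Y ?X ?k"
    using k img by (auto simp: homeomorphic_maps_def topspace_subtopology_pointwise f_inv_into_f)
  also have "\<dots> \<longleftrightarrow> ?L1 \<and> ?L2"
    unfolding continuous_map_pointwise_iff img[symmetric] by (simp add: k image_subset_iff)
  finally show ?thesis .
qed

section \<open>Permutation groups and their closures\<close>

lemma carrier_BijGroup_UNIV: "carrier (BijGroup UNIV) = {f. bij f}"
  by (auto simp: BijGroup_def Bij_def)

lemma mult_BijGroup_UNIV: "bij f \<Longrightarrow> bij g \<Longrightarrow> f \<otimes>\<^bsub>BijGroup UNIV\<^esub> g = f \<circ> g"
  by (auto simp: BijGroup_def Bij_def compose_def)

lemma subgroup_BijGroup_UNIV_iff: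
  "subgroup G (BijGroup UNIV) \<longleftrightarrow>
    (\<forall>g\<in>G. bij g \<and> inv g \<in> G) \<and> id \<in> G \<and> (\<forall>f\<in>G. \<forall>g\<in>G. f \<circ> g \<in> G)"
proof -
  have one: "\<one>\<^bsub>BijGroup UNIV\<^esub> = (id :: 'a \<Rightarrow> 'a)"
    by (auto simp: BijGroup_def)
  have inv: "m_inv (BijGroup UNIV) g = inv g" if "bij g" for g :: "'a \<Rightarrow> 'a"
    using that by (simp add: inv_BijGroup Bij_def restrict_def)
  show ?thesis
    by (auto simp: subgroup_def carrier_BijGroup_UNIV mult_BijGroup_UNIV one inv subset_iff)
qed

text \<open>A group that is closed among the permutations loses nothing when the closure is taken among all
  functions and cut back to permutations; so the units of the closure are the group itself.\<close>

lemma closed_permutation_group_closure_bij: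
  assumes "closed_permutation_group G"
    and "f \<in> pointwise_topology closure_of G" and "bij f"
  shows "f \<in> G"
proof -
  have G: "G \<subseteq> {f. bij f}"
    using assms(1) subgroup.subset
    unfolding closed_permutation_group_def carrier_BijGroup_UNIV[symmetric] by blast
  have "subtopology pointwise_topology {f. bij f} closure_of G = G"
    using assms(1) by (simp add: closed_permutation_group_def carrier_BijGroup_UNIV closure_of_eq)
  then show ?thesis
    using assms(2,3) G by (auto simp: closure_of_subtopology Int_absorb1)
qed

text \<open>Inversion is continuous on permutations: the values of \<open>inv f\<close> on a finite set \<open>F\<close> are
  determined by those of \<open>f\<close> on \<open>inv f ` F\<close>. So both conditions \<open>f \<in> N\<close> and \<open>inv f \<in> N\<close> are
  closed.\<close>

lemma closed_permutation_group_units: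
  assumes "closed_transformation_monoid N"
  shows "closed_permutation_group {f \<in> N. bij f \<and> inv f \<in> N}" (is "closed_permutation_group ?H")
proof -
  have id: "id \<in> N" and comp: "\<And>f g. f \<in> N \<Longrightarrow> g \<in> N \<Longrightarrow> f \<circ> g \<in> N"
    and closed: "pointwise_topology closure_of N = N"
    using assms by (auto simp: closed_transformation_monoid_def submonoid_def
        transformation_monoid_def closedin_pointwise_iff)
  have subgroup: "subgroup ?H (BijGroup UNIV)"
    by (auto simp: subgroup_BijGroup_UNIV_iff id comp o_inv_distrib bij_comp bij_imp_bij_inv inv_inv_eq)
  have "f \<in> ?H" if f: "f \<in> pointwise_topology closure_of ?H" "bij f" for f
  proof -
    have "f \<in> pointwise_topology closure_of N"
      using f(1) closure_of_mono[of ?H N pointwise_topology] by auto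
    moreover have "inv f \<in> pointwise_topology closure_of N"
      unfolding in_pointwise_closure_iff
    proof (intro allI impI)
      fix F :: "'a set" assume "finite F"
      then obtain g where g: "g \<in> ?H" "\<forall>x\<in>inv f ` F. g x = f x"
        using f(1) unfolding in_pointwise_closure_iff by (meson finite_imageI)
      have "inv g y = inv f y" if "y \<in> F" for y
      proof -
        have "g (inv f y) = y"
          using g(2) that f(2) by (simp add: bij_is_surj surj_f_inv_f)
        then show ?thesis using g(1) by (metis (no_types, lifting) bij_inv_eq_iff mem_Collect_eq)
      qed
      with g(1) show "\<exists>g\<in>N. \<forall>y\<in>F. g y = inv f y" by blast
    qed
    ultimately show ?thesis using f(2) closed by simp
  qed
  then have "{f. bij f} \<inter> pointwise_topology closure_of ?H = ?H"
    using subset_pointwise_closure[of ?H] by blast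
  moreover have "{f. bij f} \<inter> ?H = ?H" by blast
  ultimately have "subtopology pointwise_topology {f. bij f} closure_of ?H = ?H"
    by (simp only: closure_of_subtopology)
  with subgroup show ?thesis
    unfolding closed_permutation_group_def carrier_BijGroup_UNIV closure_of_eq[symmetric] ..
qed

section \<open>Extending a group isomorphism to the closures\<close>

text \<open>The point is that an isomorphism \<open>h\<close> of monoids is only known to be continuous on the group,
  whereas its values on the rest of \<open>M\<close> are constrained by algebra alone. The continuous extension
  \<open>\<xi>\<close> of \<open>h\<close> from the group takes values in the same monoid because that monoid is closed, so \<open>h\<close>
  can be compared with \<open>\<xi>\<close> inside \<open>M\<close>, where rigidity applies.\<close>

theorem monoid_automatic_homeomorphicity_closure:
  fixes G :: "('a \<Rightarrow> 'a) set"
  defines "M \<equiv> pointwise_topology closure_of G"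
  assumes G: "group_automatic_homeomorphicity G"
    and rigid: "\<And>\<phi>. \<lbrakk>\<phi> ` M \<subseteq> M; inj_on \<phi> M; \<forall>f\<in>M. \<forall>g\<in>M. \<phi> (f \<circ> g) = \<phi> f \<circ> \<phi> g;
      \<forall>g\<in>G. \<phi> g = g\<rbrakk> \<Longrightarrow> \<forall>f\<in>M. \<phi> f = f"
  shows "monoid_automatic_homeomorphicity M"
proof -
  have closed_G: "closed_permutation_group G"
    using G by (simp add: group_automatic_homeomorphicity_def)
  then have bij_G: "bij g" and inv_G: "inv g \<in> G" if "g \<in> G" for g
    using that by (auto simp: closed_permutation_group_def subgroup_BijGroup_UNIV_iff)
  from closed_G have id_G: "id \<in> G" and comp_G: "\<And>f g. f \<in> G \<Longrightarrow> g \<in> G \<Longrightarrow> f \<circ> g \<in> G"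
    by (auto simp: closed_permutation_group_def subgroup_BijGroup_UNIV_iff)
  have GM: "G \<subseteq> M" unfolding M_def by (rule subset_pointwise_closure)
  have comp_M: "f \<circ> g \<in> M" if "f \<in> M" "g \<in> M" for f g
    using that comp_G unfolding M_def by (rule pointwise_closure_comp[rotated 1])
  have approx: "\<exists>g\<in>G. \<forall>x\<in>F. g x = f x" if "f \<in> M" "finite F" for f F
    using that unfolding M_def in_pointwise_closure_iff by blast
  have "closed_transformation_monoid M"
    using GM id_G comp_M
    by (auto simp: closed_transformation_monoid_def submonoid_def transformation_monoid_def M_def)
  moreover have "homeomorphic_map (subtopology pointwise_topology M) (subtopology pointwise_topology N) h"
    if closed_N: "closed_transformation_monoid N"
      and iso: "h \<in> iso (transformation_monoid\<lparr>carrier := M\<rparr>) (transformation_monoid\<lparr>carrier := N\<rparr>)"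
    for N :: "('a \<Rightarrow> 'a) set" and h
  proof -
    have bij_h: "bij_betw h M N" and h_comp: "\<And>f g. f \<in> M \<Longrightarrow> g \<in> M \<Longrightarrow> h (f \<circ> g) = h f \<circ> h g"
      using iso by (auto simp: iso_def hom_def transformation_monoid_def)
    have h_N: "h f \<in> N" if "f \<in> M" for f
      using bij_h that by (rule bij_betwE[rule_format])
    have id_N: "id \<in> N" and N_closure: "pointwise_topology closure_of N = N"
      using closed_N by (auto simp: closed_transformation_monoid_def submonoid_def
        transformation_monoid_def closedin_pointwise_iff)
    have h_id: "h id = id"
    proof -
      obtain e where "e \<in> M" "h e = id"
        using bij_h id_N by (metis bij_betw_iff_bijections)
      then show ?thesis
        using h_comp[of id e] GM id_G by auto
    qed
    define H where "H = {f \<in> N. bij f \<and> inv f \<in> N}"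
    have h_inv: "h (inv g) \<circ> h g = id" "h g \<circ> h (inv g) = id" if "g \<in> G" for g
    proof -
      have "g \<in> M" "inv g \<in> M" using that inv_G GM by auto
      moreover have "inv g \<circ> g = id" "g \<circ> inv g = id"
        using bij_G[OF that] by (auto simp: fun_eq_iff bij_is_inj bij_is_surj surj_f_inv_f)
      ultimately show "h (inv g) \<circ> h g = id" "h g \<circ> h (inv g) = id"
        using h_comp h_id by metis+
    qed
    have "h ` G = H"
    proof (intro equalityI subsetI)
      fix k assume "k \<in> h ` G"
      then obtain g where g: "g \<in> G" "k = h g" by blast
      have "bij k" using h_inv[OF g(1)] g(2) o_bij by blast
      moreover have "inv k = h (inv g)"
        using h_inv[OF g(1)] g(2) by (metis inv_unique_comp)
      ultimately show "k \<in> H" unfolding H_def using g h_N inv_G GM by auto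
    next
      fix k assume "k \<in> H"
      then have k: "k \<in> N" "bij k" "inv k \<in> N" by (auto simp: H_def)
      obtain f f' where f: "f \<in> M" "k = h f" "f' \<in> M" "inv k = h f'"
        using k bij_h by (metis bij_betw_imp_surj_on imageE)
      have "k \<circ> inv k = id" "inv k \<circ> k = id"
        using k(2) by (auto simp: fun_eq_iff bij_is_inj bij_is_surj surj_f_inv_f)
      then have "h (f \<circ> f') = h id" "h (f' \<circ> f) = h id"
        unfolding h_comp[OF f(1,3)] h_comp[OF f(3,1)] h_id f(2,4)[symmetric] .
      then have "f \<circ> f' = id" "f' \<circ> f = id"
        using bij_h f comp_M GM id_G by (metis bij_betw_imp_inj_on inj_onD subsetD)+
      then have "bij f" by (metis o_bij)
      then have "f \<in> G"
        using closed_permutation_group_closure_bij[OF closed_G] f(1) by (simp add: M_def)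
      then show "k \<in> h ` G" using f(2) by blast
    qed
    then have bij_hG: "bij_betw h G H"
      using bij_h GM by (meson bij_betw_subset)
    have "h \<in> iso (BijGroup UNIV\<lparr>carrier := G\<rparr>) (BijGroup UNIV\<lparr>carrier := H\<rparr>)"
    proof -
      have "h (f \<otimes>\<^bsub>BijGroup UNIV\<^esub> g) = h f \<otimes>\<^bsub>BijGroup UNIV\<^esub> h g" if "f \<in> G" "g \<in> G" for f g
      proof -
        have "bij (h f)" "bij (h g)" using bij_hG that by (auto simp: H_def dest!: bij_betwE)
        then show ?thesis using that GM by (simp add: mult_BijGroup_UNIV bij_G h_comp subset_iff)
      qed
      then show ?thesis using bij_hG by (auto simp: iso_def hom_def dest: bij_betwE)
    qed
    then have "homeomorphic_map (subtopology pointwise_topology G) (subtopology pointwise_topology H) h"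
      using G closed_permutation_group_units[OF closed_N]
      unfolding group_automatic_homeomorphicity_def H_def by blast
    then have cont: "\<forall>f\<in>G. \<forall>x. \<exists>F. finite F \<and> (\<forall>g\<in>G. (\<forall>y\<in>F. g y = f y) \<longrightarrow> h g x = h f x)"
      and cont_inv: "\<forall>f\<in>G. \<forall>x. \<exists>F. finite F \<and> (\<forall>g\<in>G. (\<forall>y\<in>F. h g y = h f y) \<longrightarrow> g x = f x)"
      unfolding homeomorphic_map_pointwise_iff[OF bij_hG] by blast+
    \<comment> \<open>By translation, continuity at the identity is uniform: one finite set serves all of \<open>G\<close>.\<close>
    have "\<exists>F. finite F \<and> (\<forall>g\<in>G. \<forall>g'\<in>G. (\<forall>y\<in>F. g y = g' y) \<longrightarrow> h g x = h g' x)" for x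
    proof -
      obtain F where F: "finite F" "\<forall>g\<in>G. (\<forall>y\<in>F. g y = id y) \<longrightarrow> h g x = h id x"
        using bspec[OF cont id_G, THEN spec, of x] by (elim exE conjE)
      have "h g x = h g' x" if g: "g \<in> G" "g' \<in> G" "\<forall>y\<in>F. g y = g' y" for g g'
      proof -
        have "\<forall>y\<in>F. (inv g' \<circ> g) y = id y"
          using g bij_G by (simp add: bij_is_inj)
        then have "h (inv g' \<circ> g) x = x"
          using F(2) g inv_G comp_G by (simp add: h_id)
        then have "h (inv g') (h g x) = x"
          using g inv_G GM by (simp add: h_comp subset_iff)
        then show ?thesis using h_inv(2)[OF g(2)] by (metis comp_apply id_apply)
      qed
      with F(1) show ?thesis by blast
    qed
    then obtain S where S: "\<And>x. finite (S x)"
      "\<And>x g g'. \<lbrakk>g \<in> G; g' \<in> G; \<forall>y\<in>S x. g y = g' y\<rbrakk> \<Longrightarrow> h g x = h g' x"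
      by metis
    have "\<exists>F. finite F \<and> (\<forall>g\<in>G. \<forall>g'\<in>G. (\<forall>y\<in>F. h g y = h g' y) \<longrightarrow> g x = g' x)" for x
    proof -
      obtain F where F: "finite F" "\<forall>g\<in>G. (\<forall>y\<in>F. h g y = h id y) \<longrightarrow> g x = id x"
        using bspec[OF cont_inv id_G, THEN spec, of x] by (elim exE conjE)
      have "g x = g' x" if g: "g \<in> G" "g' \<in> G" "\<forall>y\<in>F. h g y = h g' y" for g g'
      proof -
        have "h (inv g' \<circ> g) y = h id y" if "y \<in> F" for y
        proof -
          have "h (inv g' \<circ> g) y = (h (inv g') \<circ> h g') y"
            using g that inv_G GM by (simp add: h_comp subset_iff)
          then show ?thesis by (simp only: h_inv(1)[OF g(2)] h_id)
        qed
        then have "inv g' (g x) = x"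
          using F(2) g inv_G comp_G by force
        then show ?thesis using bij_G[OF g(2)] by (metis bij_inv_eq_iff)
      qed
      with F(1) show ?thesis by blast
    qed
    then obtain E where E: "\<And>x. finite (E x)"
      "\<And>x g g'. \<lbrakk>g \<in> G; g' \<in> G; \<forall>y\<in>E x. h g y = h g' y\<rbrakk> \<Longrightarrow> g x = g' x"
      by metis
    \<comment> \<open>The value at \<open>x\<close> is that of \<open>h g\<close> for any \<open>g\<close> in \<open>G\<close> close enough to \<open>f\<close>; by the choice of
      \<open>S x\<close> all such \<open>g\<close> give the same value.\<close>
    define \<xi> where "\<xi> = (\<lambda>f x. h (SOME g. g \<in> G \<and> (\<forall>y\<in>S x. g y = f y)) x)"
    have \<xi>_eq: "\<xi> f x = h g x" if "f \<in> M" "g \<in> G" "\<forall>y\<in>S x. g y = f y" for f g x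
    proof -
      let ?g = "SOME g. g \<in> G \<and> (\<forall>y\<in>S x. g y = f y)"
      have "?g \<in> G \<and> (\<forall>y\<in>S x. ?g y = f y)"
        by (rule someI[of _ g]) (use that in auto)
      then show ?thesis unfolding \<xi>_def by (intro S(2)) (use that in auto)
    qed
    have \<xi>_approx: "\<exists>g\<in>G. (\<forall>y\<in>K. g y = f y) \<and> (\<forall>x\<in>F. \<xi> f x = h g x)"
      if f: "f \<in> M" and fin: "finite K" "finite F" for f K F
    proof -
      obtain g where g: "g \<in> G" "\<forall>y\<in>K \<union> (\<Union>x\<in>F. S x). g y = f y"
        using approx[of f "K \<union> (\<Union>x\<in>F. S x)"] f fin S(1) by auto
      then show ?thesis using f by (intro bexI[of _ g]) (auto intro!: \<xi>_eq)
    qed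
    have \<xi>_N: "\<xi> f \<in> N" if f: "f \<in> M" for f
    proof -
      have "\<xi> f \<in> pointwise_topology closure_of N"
        unfolding in_pointwise_closure_iff
      proof (intro allI impI)
        fix F :: "'a set" assume "finite F"
        then obtain g where "g \<in> G" "\<forall>x\<in>F. \<xi> f x = h g x"
          using \<xi>_approx[OF f, of "{}" F] by auto
        then show "\<exists>k\<in>N. \<forall>x\<in>F. k x = \<xi> f x"
          using h_N GM by (intro bexI[of _ "h g"]) auto
      qed
      then show ?thesis by (simp add: N_closure)
    qed
    have \<xi>_comp: "\<xi> (f \<circ> g) = \<xi> f \<circ> \<xi> g" if fg: "f \<in> M" "g \<in> M" for f g
    proof
      fix x
      obtain g' where g': "g' \<in> G" "\<forall>y\<in>S x. g' y = g y" "\<xi> g x = h g' x"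
        using \<xi>_approx[OF fg(2), of "S x" "{x}"] S(1) by auto
      obtain f' where f': "f' \<in> G" "\<forall>y\<in>g ` S x. f' y = f y" "\<xi> f (\<xi> g x) = h f' (\<xi> g x)"
        using \<xi>_approx[OF fg(1), of "g ` S x" "{\<xi> g x}"] S(1) by auto
      have "\<xi> (f \<circ> g) x = h (f' \<circ> g') x"
        using f' g' fg by (intro \<xi>_eq comp_M comp_G) auto
      then show "\<xi> (f \<circ> g) x = (\<xi> f \<circ> \<xi> g) x"
        using f' g' GM by (simp add: h_comp subset_iff)
    qed
    \<comment> \<open>Continuity of the inverse on the group passes to \<open>\<xi>\<close> and also yields its injectivity.\<close>
    have \<xi>_cont_inv: "f x = f' x" if fg: "f \<in> M" "f' \<in> M" "\<forall>y\<in>E x. \<xi> f y = \<xi> f' y" for f f' x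
    proof -
      obtain g where g: "g \<in> G" "g x = f x" "\<forall>y\<in>E x. \<xi> f y = h g y"
        using \<xi>_approx[OF fg(1), of "{x}" "E x"] E(1) by auto
      obtain g' where g': "g' \<in> G" "g' x = f' x" "\<forall>y\<in>E x. \<xi> f' y = h g' y"
        using \<xi>_approx[OF fg(2), of "{x}" "E x"] E(1) by auto
      have "g x = g' x"
        using g g' fg(3) by (intro E(2)) auto
      then show ?thesis using g g' by simp
    qed
    have \<xi>_cont: "\<xi> f x = \<xi> f' x" if fg: "f \<in> M" "f' \<in> M" "\<forall>y\<in>S x. f y = f' y" for f f' x
    proof -
      obtain g where g: "g \<in> G" "\<forall>y\<in>S x. g y = f y"
        using approx[OF fg(1)] S(1) by blast
      then have "\<xi> f x = h g x" "\<xi> f' x = h g x"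
        using fg by (auto intro!: \<xi>_eq)
      then show ?thesis by simp
    qed
    have \<xi>_G: "\<xi> g = h g" if "g \<in> G" for g
      using that GM by (intro ext \<xi>_eq) auto
    let ?\<phi> = "\<lambda>f. inv_into M h (\<xi> f)"
    have h\<phi>: "h (?\<phi> f) = \<xi> f" and \<phi>M: "?\<phi> f \<in> M" if "f \<in> M" for f
      using \<xi>_N[OF that] bij_h
      by (auto simp: bij_betw_def f_inv_into_f intro!: inv_into_into)
    have inv_h: "inv_into M h (h f) = f" if "f \<in> M" for f
      using bij_h that by (simp add: bij_betw_def)
    have "\<forall>f\<in>M. ?\<phi> f = f"
    proof (rule rigid)
      show "?\<phi> ` M \<subseteq> M" using \<phi>M by blast
      show "inj_on ?\<phi> M"
      proof (rule inj_onI)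
        fix f g assume "f \<in> M" "g \<in> M" "?\<phi> f = ?\<phi> g"
        then have "\<xi> f = \<xi> g" by (metis h\<phi>)
        then show "f = g" using \<open>f \<in> M\<close> \<open>g \<in> M\<close> by (intro ext \<xi>_cont_inv) auto
      qed
      show "\<forall>f\<in>M. \<forall>g\<in>M. ?\<phi> (f \<circ> g) = ?\<phi> f \<circ> ?\<phi> g"
      proof (intro ballI)
        fix f g assume fg: "f \<in> M" "g \<in> M"
        then have "h (?\<phi> f \<circ> ?\<phi> g) = \<xi> (f \<circ> g)"
          by (simp add: h_comp \<phi>M h\<phi> \<xi>_comp)
        then show "?\<phi> (f \<circ> g) = ?\<phi> f \<circ> ?\<phi> g"
          using inv_h[of "?\<phi> f \<circ> ?\<phi> g"] fg by (simp add: comp_M \<phi>M)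
      qed
      show "\<forall>g\<in>G. ?\<phi> g = g" using GM by (simp add: \<xi>_G inv_h subset_iff)
    qed
    then have h_\<xi>: "h f = \<xi> f" if "f \<in> M" for f
      using h\<phi> that by metis
    show ?thesis
      unfolding homeomorphic_map_pointwise_iff[OF bij_h]
    proof (intro conjI ballI allI)
      fix f x assume f: "f \<in> M"
      show "\<exists>F. finite F \<and> (\<forall>g\<in>M. (\<forall>y\<in>F. g y = f y) \<longrightarrow> h g x = h f x)"
      proof (intro exI conjI ballI impI)
        show "finite (S x)" by (rule S(1))
        show "h g x = h f x" if "g \<in> M" "\<forall>y\<in>S x. g y = f y" for g
          using \<xi>_cont[OF that(1) f that(2)] that(1) f by (simp only: h_\<xi>)
      qed
      show "\<exists>F. finite F \<and> (\<forall>g\<in>M. (\<forall>y\<in>F. h g y = h f y) \<longrightarrow> g x = f x)"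
      proof (intro exI conjI ballI impI)
        show "finite (E x)" by (rule E(1))
        show "g x = f x" if "g \<in> M" "\<forall>y\<in>E x. h g y = h f y" for g
          using that f by (intro \<xi>_cont_inv) (simp_all only: h_\<xi>)
      qed
    qed
  qed
  ultimately show ?thesis
    unfolding monoid_automatic_homeomorphicity_def by blast
qed

section \<open>Groups without algebraicity\<close>

text \<open>Over a finite set \<open>A\<close>, points outside \<open>A\<close> have infinite orbits: if the orbit of \<open>x\<close> were finite,
  then fixing \<open>A\<close> and all points of the orbit other than \<open>x\<close> would force \<open>x\<close> to be fixed too.\<close>

lemma no_algebraicity_moves_outside:
  assumes "no_algebraicity G" and "\<And>g. g \<in> G \<Longrightarrow> inj g"
    and "finite A" and "finite N" and "x \<notin> A"
  obtains g where "g \<in> G" and "\<And>a. a \<in> A \<Longrightarrow> g a = a" and "g x \<notin> N"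
proof (rule ccontr)
  assume "\<not> thesis"
  define Orb where "Orb = {g x | g. g \<in> G \<and> (\<forall>a\<in>A. g a = a)}"
  have "Orb \<subseteq> N" using \<open>\<not> thesis\<close> that unfolding Orb_def by blast
  then have "finite (A \<union> (Orb - {x}))" using assms(3,4) finite_subset by auto
  from finite_list[OF this] obtain as where as: "set as = A \<union> (Orb - {x})" ..
  then have "x \<notin> set as" using assms(5) by blast
  then obtain g where g: "g \<in> G" "\<forall>a\<in>set as. g a = a" "g x \<noteq> x"
    using assms(1) unfolding no_algebraicity_def by blast
  then have "g x \<in> Orb - {x}" using as unfolding Orb_def by blast
  then have "g (g x) = g x" using g(2) as by simp
  then show False using assms(2)[OF g(1)] g(3) by (auto dest: injD)
qed

text \<open>The range of the function omits a point of every orbit under the stabilizer of a point \<open>z\<close>,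
  apart from \<open>{z}\<close> itself. It is a limit of permutations \<open>g\<close>, built along with a growing finite set \<open>N\<close>
  of forbidden values. As all relevant orbits are infinite, there is always room to choose the
  next value outside \<open>N\<close> and, treating the pairs \<open>x \<noteq> z\<close> one after another, to forbid a point in the
  orbit of \<open>x\<close> under the stabilizer of \<open>z\<close> that is not yet a value.\<close>

lemma sparse_range_exists:
  fixes G :: "('a \<Rightarrow> 'a) set"
  assumes "countable (UNIV :: 'a set)"
    and "subgroup G (BijGroup UNIV)" and "no_algebraicity G"
  obtains f where "f \<in> pointwise_topology closure_of G"
    and "\<And>x z. x \<noteq> z \<Longrightarrow> \<exists>g\<in>G. g z = z \<and> g x \<notin> range f"
proof -
  have id_G: "id \<in> G" and comp_G: "\<And>f g. f \<in> G \<Longrightarrow> g \<in> G \<Longrightarrow> f \<circ> g \<in> G"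
    and bij_G: "\<And>g. g \<in> G \<Longrightarrow> bij g"
    using assms(2) by (auto simp: subgroup_BijGroup_UNIV_iff)
  note moves = no_algebraicity_moves_outside[OF assms(3) bij_is_inj[OF bij_G]]
  have "countable (UNIV :: ('a \<times> 'a) set)"
    using countable_SIGMA[OF assms(1), of "\<lambda>_. UNIV"] assms(1) by simp
  then obtain pair :: "nat \<Rightarrow> 'a \<times> 'a" where pair: "range pair = UNIV"
    by (metis UNIV_not_empty uncountable_def)
  obtain e :: "nat \<Rightarrow> 'a" where e: "range e = UNIV"
    using assms(1) by (metis UNIV_not_empty uncountable_def)
  define K where "K = (\<lambda>n. e ` {..<n})"
  define P :: "nat \<Rightarrow> ('a \<Rightarrow> 'a) \<times> 'a set \<Rightarrow> bool"
    where "P = (\<lambda>n (g, N). g \<in> G \<and> finite N \<and> g ` K n \<inter> N = {})"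
  define Q :: "nat \<Rightarrow> ('a \<Rightarrow> 'a) \<times> 'a set \<Rightarrow> ('a \<Rightarrow> 'a) \<times> 'a set \<Rightarrow> bool"
    where "Q = (\<lambda>n (g, N) (g', N'). (\<forall>y\<in>K n. g' y = g y) \<and> N \<subseteq> N' \<and>
    (case pair n of (x, z) \<Rightarrow> x \<noteq> z \<longrightarrow> (\<exists>\<alpha>\<in>G. \<alpha> z = z \<and> \<alpha> x \<in> N')))"
  have "\<exists>s. \<forall>n. P n (s n) \<and> Q n (s n) (s (Suc n))"
  proof (rule dependent_nat_choice)
    show "\<exists>t. P 0 t" using id_G by (auto simp: P_def K_def)
  next
    fix t :: "('a \<Rightarrow> 'a) \<times> 'a set" and n assume "P n t"
    then obtain g N where t: "t = (g, N)" and g: "g \<in> G" "finite N" "g ` K n \<inter> N = {}"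
      by (cases t) (auto simp: P_def)
    have K_fin: "finite (K m)" for m by (simp add: K_def)
    have K_Suc: "K (Suc n) = insert (e n) (K n)" by (simp add: K_def lessThan_Suc)
    obtain g' where g': "g' \<in> G" "\<forall>y\<in>K n. g' y = g y" "g' ` K (Suc n) \<inter> N = {}"
    proof (cases "e n \<in> K n")
      case True
      then show thesis using g that[of g] by (auto simp: K_Suc insert_absorb)
    next
      case False
      then have "g (e n) \<notin> g ` K n" using bij_is_inj[OF bij_G[OF g(1)]] by (simp add: inj_image_mem_iff)
      then obtain \<beta> where "\<beta> \<in> G" "\<And>a. a \<in> g ` K n \<Longrightarrow> \<beta> a = a" "\<beta> (g (e n)) \<notin> N"
        using moves[of "g ` K n" N "g (e n)"] K_fin g(2) by blast
      then show thesis using that[of "\<beta> \<circ> g"] g comp_G by (auto simp: K_Suc)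
    qed
    \<comment> \<open>The next value is settled before a new one is forbidden, so that the forbidden point can be
      chosen outside the current finite range.\<close>
    obtain x z where xz: "pair n = (x, z)" by fastforce
    obtain N' where N': "finite N'" "N \<subseteq> N'" "g' ` K (Suc n) \<inter> N' = {}"
      "x \<noteq> z \<longrightarrow> (\<exists>\<alpha>\<in>G. \<alpha> z = z \<and> \<alpha> x \<in> N')"
    proof (cases "x = z")
      case True
      then show thesis using that[of N] g(2) g'(3) by auto
    next
      case False
      then obtain \<alpha> where "\<alpha> \<in> G" "\<alpha> z = z" "\<alpha> x \<notin> g' ` K (Suc n)"
        using moves[of "{z}" "g' ` K (Suc n)" x] K_fin by auto
      then show thesis using that[of "insert (\<alpha> x) N"] g(2) g'(3) by auto
    qed
    show "\<exists>t'. P (Suc n) t' \<and> Q n t t'"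
      using g' N' by (intro exI[of _ "(g', N')"]) (auto simp: P_def Q_def t xz)
  qed
  then obtain s where s: "\<And>n. P n (s n)" "\<And>n. Q n (s n) (s (Suc n))" by blast
  define g where "g = (\<lambda>n. fst (s n))"
  define N where "N = (\<lambda>n. snd (s n))"
  have g: "g n \<in> G" "g n ` K n \<inter> N n = {}" for n
    using s(1)[of n] by (auto simp: P_def g_def N_def split: prod.splits)
  have step: "\<forall>y\<in>K n. g (Suc n) y = g n y" "N n \<subseteq> N (Suc n)"
    "pair n = (x, z) \<Longrightarrow> x \<noteq> z \<Longrightarrow> \<exists>\<alpha>\<in>G. \<alpha> z = z \<and> \<alpha> x \<in> N (Suc n)" for n x z
    using s(2)[of n] by (auto simp: Q_def g_def N_def split: prod.splits)
  have "mono K" by (auto simp: K_def mono_def)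
  moreover have "(\<Union>n. K n) = UNIV" using e by (auto simp: K_def image_UN[symmetric] UN_lessThan_UNIV)
  ultimately obtain f where f: "f \<in> pointwise_topology closure_of G"
    "\<And>n y. y \<in> K n \<Longrightarrow> f y = g n y"
    using pointwise_limit_in_closure[of g G K] g(1) step(1) by blast
  have "N n \<inter> range f = {}" for n
  proof -
    have False if "f y \<in> N n" for y
    proof -
      obtain m where "y \<in> K m" using \<open>(\<Union>n. K n) = UNIV\<close> by blast
      then have "y \<in> K (max m n)" using monoD[OF \<open>mono K\<close>, of m "max m n"] by auto
      moreover have "N n \<subseteq> N (max m n)" by (rule lift_Suc_mono_le[of N, OF step(2)]) simp
      ultimately show False using that f(2)[of y "max m n"] g(2)[of "max m n"] by auto
    qed
    then show ?thesis by blast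
  qed
  moreover have "\<exists>n. \<exists>\<alpha>\<in>G. \<alpha> z = z \<and> \<alpha> x \<in> N n" if "x \<noteq> z" for x z
    by (metis pair step(3) that rangeE UNIV_I)
  ultimately show thesis using f(1) that[of f] by blast
qed

section \<open>Rigidity of the closure over the group\<close>

text \<open>The assumption \<open>separate\<close> turns the omission of a value into an equation \<open>e1 \<circ> f = e2 \<circ> f\<close>,
  which \<open>\<phi>\<close> respects. To read off from \<open>\<phi> e1 \<circ> \<phi> f = \<phi> e2 \<circ> \<phi> f\<close> that \<open>\<phi> f\<close> omits the same value,
  one has to know that \<open>\<phi> e1\<close> and \<open>\<phi> e2\<close> still differ at that very point; this is what the sparse
  functions are for.\<close>

theorem endomorphism_fixing_group_is_identity:
  fixes G :: "('a \<Rightarrow> 'a) set"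
  defines "M \<equiv> pointwise_topology closure_of G"
  assumes "countable (UNIV :: 'a set)"
    and "subgroup G (BijGroup UNIV)" and "no_algebraicity G"
    and separate: "\<And>x. \<exists>e1\<in>M. \<exists>e2\<in>M. \<forall>y. e1 y = e2 y \<longleftrightarrow> y \<noteq> x"
    and into: "\<phi> ` M \<subseteq> M" and inj: "inj_on \<phi> M"
    and mult: "\<forall>f\<in>M. \<forall>g\<in>M. \<phi> (f \<circ> g) = \<phi> f \<circ> \<phi> g"
    and fix_G: "\<forall>g\<in>G. \<phi> g = g"
  shows "\<forall>f\<in>M. \<phi> f = f"
proof -
  have comp_G: "\<And>f g. f \<in> G \<Longrightarrow> g \<in> G \<Longrightarrow> f \<circ> g \<in> G"
    and bij_G: "\<And>g. g \<in> G \<Longrightarrow> bij g" and inv_G: "\<And>g. g \<in> G \<Longrightarrow> inv g \<in> G"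
    using assms(3) by (auto simp: subgroup_BijGroup_UNIV_iff)
  have GM: "G \<subseteq> M" unfolding M_def by (rule subset_pointwise_closure)
  have comp_M: "f \<circ> g \<in> M" if "f \<in> M" "g \<in> M" for f g
    using that comp_G unfolding M_def by (rule pointwise_closure_comp[rotated 1])
  have inj_M: "inj f" if "f \<in> M" for f
    using that bij_G bij_is_inj unfolding M_def by (metis pointwise_closure_injective)
  obtain f0 where f0: "f0 \<in> M" "\<And>x z. x \<noteq> z \<Longrightarrow> \<exists>g\<in>G. g z = z \<and> g x \<notin> range f0"
    using sparse_range_exists[OF assms(2,3,4)] unfolding M_def by metis
  \<comment> \<open>Both \<open>f0\<close> and \<open>\<phi> f0\<close> are translated by the same group element, because \<open>\<phi>\<close> fixes \<open>G\<close>. It carries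
    \<open>\<phi> f0 a\<close> to \<open>a\<close> and, by sparseness, a point outside the range of \<open>f0\<close> to \<open>b\<close>.\<close>
  have hit: "\<exists>k\<in>M. b \<notin> range k \<and> a \<in> range (\<phi> k)" if "a \<noteq> b" for a b
  proof -
    have "\<phi> f0 \<in> M" using into f0(1) by blast
    then obtain g where g: "g \<in> G" "g a = \<phi> f0 a"
      unfolding M_def in_pointwise_closure_iff by (metis finite.emptyI finite.insertI insertI1)
    have "g b \<noteq> g a" using that bij_is_inj[OF bij_G[OF g(1)]] by (auto dest: injD)
    then obtain \<alpha> where \<alpha>: "\<alpha> \<in> G" "\<alpha> (g a) = g a" "\<alpha> (g b) \<notin> range f0"
      using f0(2) by blast
    define \<gamma> where "\<gamma> = \<alpha> \<circ> g"
    have \<gamma>: "\<gamma> \<in> G" using \<alpha> g comp_G by (simp add: \<gamma>_def)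
    have inv_\<gamma>: "inv \<gamma> y = x \<longleftrightarrow> y = \<gamma> x" for x y
      using bij_G[OF \<gamma>] by (metis bij_inv_eq_iff)
    have "\<phi> (inv \<gamma> \<circ> f0) = inv \<gamma> \<circ> \<phi> f0"
      using mult fix_G inv_G[OF \<gamma>] f0(1) GM by (simp add: subset_iff)
    then have "\<phi> (inv \<gamma> \<circ> f0) a = a"
      using \<alpha>(2) g(2) inv_\<gamma> by (simp add: \<gamma>_def)
    moreover have "b \<notin> range (inv \<gamma> \<circ> f0)"
    proof
      assume "b \<in> range (inv \<gamma> \<circ> f0)"
      then obtain y where "inv \<gamma> (f0 y) = b" by auto
      then have "f0 y = \<gamma> b" by (simp only: inv_\<gamma>)
      then have "f0 y = \<alpha> (g b)" by (simp add: \<gamma>_def)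
      then show False using \<alpha>(3) by (metis rangeI)
    qed
    moreover have "inv \<gamma> \<circ> f0 \<in> M" using inv_G[OF \<gamma>] f0(1) GM comp_M by blast
    ultimately show ?thesis by (metis rangeI)
  qed
  have range_subset: "range (\<phi> f) \<subseteq> range f" if f: "f \<in> M" for f
  proof (rule ccontr)
    assume "\<not> range (\<phi> f) \<subseteq> range f"
    then obtain c where c: "\<phi> f c \<notin> range f" by blast
    obtain e1 e2 where e: "e1 \<in> M" "e2 \<in> M" "\<And>y. e1 y = e2 y \<longleftrightarrow> y \<noteq> \<phi> f c"
      using separate by blast
    have agree: "\<phi> e1 a = \<phi> e2 a" if k: "k \<in> M" "\<phi> f c \<notin> range k" "a \<in> range (\<phi> k)" for a k
    proof -
      have "k y \<noteq> \<phi> f c" for y using k(2) by (metis rangeI)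
      then have "e1 \<circ> k = e2 \<circ> k" using e(3) by (simp add: fun_eq_iff)
      then have "\<phi> e1 \<circ> \<phi> k = \<phi> e2 \<circ> \<phi> k" using mult e k(1) by metis
      then show ?thesis using k(3) by (metis comp_apply rangeE)
    qed
    have "\<phi> e1 a = \<phi> e2 a" for a
    proof (cases "a = \<phi> f c")
      case True
      then show ?thesis using agree[OF f c] by blast
    next
      case False
      then show ?thesis using hit[of a "\<phi> f c"] agree by blast
    qed
    then have "e1 = e2" using inj e by (metis ext inj_onD)
    then show False using e(3) by blast
  qed
  show ?thesis
  proof (intro ballI ext)
    fix f a assume f: "f \<in> M"
    obtain b where b: "\<phi> f a = f b" using range_subset[OF f] by blast
    \<comment> \<open>Otherwise some \<open>k\<close> omits \<open>b\<close> while \<open>\<phi> k\<close> attains \<open>a\<close>; then \<open>\<phi> (f \<circ> k)\<close> attains \<open>f b\<close>, a value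
      that \<open>f \<circ> k\<close> omits.\<close>
    have "a = b"
    proof (rule ccontr)
      assume "a \<noteq> b"
      then obtain k c where k: "k \<in> M" "b \<notin> range k" "a = \<phi> k c" using hit by blast
      have "\<phi> (f \<circ> k) c = f b" using mult f k b by simp
      then have "f b \<in> range (f \<circ> k)"
        using range_subset[OF comp_M[OF f k(1)]] by (metis rangeI subsetD)
      then show False using k(2) inj_M[OF f] by (auto dest: injD)
    qed
    then show "\<phi> f a = f a" using b by simp
  qed
qed

section \<open>The joint extension property\<close>

lemma automorphism_restrict_partial_isomorphism:
  assumes "g \<in> automorphisms \<Delta>" and "finite F"
  shows "partial_isomorphism \<Delta> ((Some \<circ> g) |` F)"
proof -
  have dom: "dom ((Some \<circ> g) |` F) = F" by (auto simp: restrict_map_def split: if_splits)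
  have "inj g" using assms(1) by (simp add: automorphisms_def bij_is_inj)
  then have "inj_on ((Some \<circ> g) |` F) F"
    by (auto simp: inj_on_def restrict_map_def dest: injD)
  moreover have "map (the \<circ> (Some \<circ> g) |` F) xs \<in> interp \<Delta> R \<longleftrightarrow> xs \<in> interp \<Delta> R"
    if "R \<in> symbols \<Delta>" "length xs = arity \<Delta> R" "set xs \<subseteq> F" for R xs
  proof -
    have eq: "map (the \<circ> (Some \<circ> g) |` F) xs = map g xs"
      using that(3) by (auto simp: restrict_map_def)
    show ?thesis
      unfolding eq using assms(1) that by (simp add: automorphisms_def self_embeddings_def)
  qed
  ultimately show ?thesis
    using assms(2) unfolding partial_isomorphism_def dom by blast
qed

text \<open>By homogeneity, finite partial isomorphisms may be replaced by automorphisms of which only the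
  restrictions to finite sets matter. If two automorphisms agree on \<open>F\<close> away from a single point, the
  inverses of their restrictions are compatible: a common value can only come from one argument.\<close>

lemma joint_extension_automorphisms:
  assumes "homogeneous \<Delta>" and "joint_extension_property \<Delta>"
    and g: "g \<in> automorphisms \<Delta>" "h \<in> automorphisms \<Delta>"
    and "finite F" and "u \<notin> F" and "\<And>y. y \<in> F \<Longrightarrow> y \<noteq> x \<Longrightarrow> g y = h y"
  obtains g' h' where "g' \<in> automorphisms \<Delta>" and "h' \<in> automorphisms \<Delta>"
    and "\<And>y. y \<in> F \<Longrightarrow> g' y = g y" and "\<And>y. y \<in> F \<Longrightarrow> h' y = h y" and "g' u = h' u"
proof -
  let ?p = "(Some \<circ> g) |` F" and ?q = "(Some \<circ> h) |` F"
  have dom: "dom ?p = F" "dom ?q = F" by (auto simp: restrict_map_def split: if_splits)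
  have inj: "inj g" "inj h" using g by (auto simp: automorphisms_def bij_is_inj)
  note joint = assms(2)[unfolded joint_extension_property_def, THEN spec, THEN spec, THEN spec,
      THEN mp, THEN mp, THEN mp, THEN mp, THEN mp]
  have agree: "\<forall>v y z. ?p y = Some v \<longrightarrow> ?q z = Some v \<longrightarrow> y = z"
    using assms(7) inj by (auto simp: restrict_map_def split: if_splits) (metis injD)
  have dom_eq: "dom ?p = dom ?q" and u: "u \<notin> dom ?p"
    using \<open>u \<notin> F\<close> by (simp_all only: dom not_False_eq_True)
  obtain p q where pq: "partial_isomorphism \<Delta> p" "partial_isomorphism \<Delta> q"
    "?p \<subseteq>\<^sub>m p" "?q \<subseteq>\<^sub>m q" "u \<in> dom p" "u \<in> dom q" "p u = q u"
    using joint[OF automorphism_restrict_partial_isomorphism[OF g(1) \<open>finite F\<close>]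
      automorphism_restrict_partial_isomorphism[OF g(2) \<open>finite F\<close>] dom_eq agree u]
    by (elim exE conjE)
  obtain g' h' where g': "g' \<in> automorphisms \<Delta>" "\<forall>y\<in>dom p. p y = Some (g' y)"
    and h': "h' \<in> automorphisms \<Delta>" "\<forall>y\<in>dom q. q y = Some (h' y)"
    using assms(1) pq(1,2) unfolding homogeneous_def by metis
  have "p y = Some (g y)" "q y = Some (h y)" if "y \<in> F" for y
    using pq(3,4) that unfolding map_le_def dom by auto
  then have "g' y = g y" "h' y = h y" if "y \<in> F" for y
    using g'(2) h'(2) that by (metis domI option.inject)+
  moreover have "g' u = h' u" using g'(2) h'(2) pq(5-7) by auto
  ultimately show thesis using that g'(1) h'(1) by blast
qed

text \<open>The identity and \<open>\<alpha>\<close>, both restricted to \<open>{x}\<close>, start the construction. The joint extension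
  property lets both maps be continued with common values forever, since agreement away from
  \<open>x\<close> is again all that the next extension requires.\<close>

lemma embeddings_differing_at_one_point:
  fixes \<Delta> :: "('r, 'a) rel_structure"
  defines "G \<equiv> automorphisms \<Delta>"
  assumes "countable (UNIV :: 'a set)" and "homogeneous \<Delta>" and "joint_extension_property \<Delta>"
    and "id \<in> G" and "\<alpha> \<in> G" and "\<alpha> x \<noteq> x"
  shows "\<exists>e1\<in>pointwise_topology closure_of G. \<exists>e2\<in>pointwise_topology closure_of G.
    \<forall>y. e1 y = e2 y \<longleftrightarrow> y \<noteq> x"
proof -
  obtain e :: "nat \<Rightarrow> 'a" where e: "range e = UNIV"
    using assms(2) by (metis UNIV_not_empty uncountable_def)
  define K where "K = (\<lambda>n. insert x (e ` {..<n}))"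
  define P :: "nat \<Rightarrow> ('a \<Rightarrow> 'a) \<times> ('a \<Rightarrow> 'a) \<Rightarrow> bool"
    where "P = (\<lambda>n (g, h). g \<in> G \<and> h \<in> G \<and> (\<forall>y\<in>K n. g y = h y \<longleftrightarrow> y \<noteq> x))"
  define Q :: "nat \<Rightarrow> ('a \<Rightarrow> 'a) \<times> ('a \<Rightarrow> 'a) \<Rightarrow> ('a \<Rightarrow> 'a) \<times> ('a \<Rightarrow> 'a) \<Rightarrow> bool"
    where "Q = (\<lambda>n (g, h) (g', h'). \<forall>y\<in>K n. g' y = g y \<and> h' y = h y)"
  have "\<exists>s. \<forall>n. P n (s n) \<and> Q n (s n) (s (Suc n))"
  proof (rule dependent_nat_choice)
    show "\<exists>t. P 0 t"
      using assms(5-7) by (intro exI[of _ "(id, \<alpha>)"]) (auto simp: P_def K_def)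
  next
    fix t :: "('a \<Rightarrow> 'a) \<times> ('a \<Rightarrow> 'a)" and n assume "P n t"
    then obtain g h where t: "t = (g, h)" and g: "g \<in> G" "h \<in> G" "\<forall>y\<in>K n. g y = h y \<longleftrightarrow> y \<noteq> x"
      by (cases t) (auto simp: P_def)
    have K_Suc: "K (Suc n) = insert (e n) (K n)" by (auto simp: K_def lessThan_Suc)
    show "\<exists>t'. P (Suc n) t' \<and> Q n t t'"
    proof (cases "e n \<in> K n")
      case True
      then show ?thesis using g by (intro exI[of _ t]) (auto simp: P_def Q_def t K_Suc)
    next
      case False
      moreover have "finite (K n)" by (simp add: K_def)
      ultimately obtain g' h' where "g' \<in> G" "h' \<in> G" "g' (e n) = h' (e n)"
        "\<And>y. y \<in> K n \<Longrightarrow> g' y = g y" "\<And>y. y \<in> K n \<Longrightarrow> h' y = h y"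
        using joint_extension_automorphisms[OF assms(3,4), of g h "K n" "e n" x] g
        unfolding G_def by metis
      moreover have "e n \<noteq> x" using False by (auto simp: K_def)
      ultimately show ?thesis
        using g(3) by (intro exI[of _ "(g', h')"]) (auto simp: P_def Q_def t K_Suc)
    qed
  qed
  then obtain s where s: "\<And>n. P n (s n)" "\<And>n. Q n (s n) (s (Suc n))" by blast
  define g where "g = (\<lambda>n. fst (s n))"
  define h where "h = (\<lambda>n. snd (s n))"
  have gh: "g n \<in> G" "h n \<in> G" "\<And>y. y \<in> K n \<Longrightarrow> g n y = h n y \<longleftrightarrow> y \<noteq> x" for n
    using s(1)[of n] by (auto simp: P_def g_def h_def split: prod.splits)
  have step: "g (Suc n) y = g n y" "h (Suc n) y = h n y" if "y \<in> K n" for n y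
    using s(2)[of n] that by (auto simp: Q_def g_def h_def split: prod.splits)
  have K: "mono K" "(\<Union>n. K n) = UNIV"
    using e by (auto simp: K_def mono_def)
  obtain e1 where e1: "e1 \<in> pointwise_topology closure_of G" "\<And>n y. y \<in> K n \<Longrightarrow> e1 y = g n y"
    using pointwise_limit_in_closure[of g G K, OF gh(1) step(1) K] by blast
  obtain e2 where e2: "e2 \<in> pointwise_topology closure_of G" "\<And>n y. y \<in> K n \<Longrightarrow> e2 y = h n y"
    using pointwise_limit_in_closure[of h G K, OF gh(2) step(2) K] by blast
  have "e1 y = e2 y \<longleftrightarrow> y \<noteq> x" for y
  proof -
    obtain n where "y \<in> K n" using K(2) by blast
    then show ?thesis using e1(2) e2(2) gh(3) by simp
  qed
  then show ?thesis using e1(1) e2(1) by blast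
qed

section \<open>Self-embedding monoids of homogeneous structures\<close>

theorem theorem21:
  fixes \<Delta> :: "('r, 'a) rel_structure"
  assumes "countable (UNIV :: 'a set)" and "infinite (UNIV :: 'a set)"
    and "relational_structure \<Delta>"
    and "homogeneous \<Delta>"
    and "joint_extension_property \<Delta>"
    and "no_algebraicity (automorphisms \<Delta>)"
    and "group_automatic_homeomorphicity (automorphisms \<Delta>)"
  shows "monoid_automatic_homeomorphicity (pointwise_topology closure_of automorphisms \<Delta>)"
proof (rule monoid_automatic_homeomorphicity_closure)
  let ?G = "automorphisms \<Delta>"
  show "group_automatic_homeomorphicity ?G" by fact
  then have subgroup: "subgroup ?G (BijGroup UNIV)"
    by (simp add: group_automatic_homeomorphicity_def closed_permutation_group_def)
  have "\<exists>\<alpha>\<in>?G. \<alpha> x \<noteq> x" for x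
    using assms(6)[unfolded no_algebraicity_def, rule_format, of "[]" x] by auto
  moreover have "id \<in> ?G" using subgroup by (simp add: subgroup_BijGroup_UNIV_iff)
  ultimately have separate: "\<exists>e1\<in>pointwise_topology closure_of ?G.
      \<exists>e2\<in>pointwise_topology closure_of ?G. \<forall>y. e1 y = e2 y \<longleftrightarrow> y \<noteq> x" for x
    using embeddings_differing_at_one_point[OF assms(1,4,5)] by blast
  show "\<forall>f\<in>pointwise_topology closure_of ?G. \<phi> f = f"
    if "\<phi> ` (pointwise_topology closure_of ?G) \<subseteq> pointwise_topology closure_of ?G"
      "inj_on \<phi> (pointwise_topology closure_of ?G)"
      "\<forall>f\<in>pointwise_topology closure_of ?G. \<forall>g\<in>pointwise_topology closure_of ?G.
        \<phi> (f \<circ> g) = \<phi> f \<circ> \<phi> g"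
      "\<forall>g\<in>?G. \<phi> g = g" for \<phi>
    using endomorphism_fixing_group_is_identity[OF assms(1) subgroup assms(6) separate that] .
qed

end
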